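(* Let $\bm{y}\in\mathbb{R}^n$, $\lambda>0$, $\gamma\in(0,1)$, and $\alpha\ge 0$. Denote by $\bm{x}^*$ an optimal solution to the problem $$\min_{\bm{x}\in\mathbb{R}^n}\ \gamma\left(\|\bm{x}\|_1-\alpha\|\bm{x}\|_2\right)+(1-\gamma)\|\bm{x}\|_2^2+\frac{1}{2\lambda}\|\bm{x}-\bm{y}\|_2^2 .$$ Then $\bm{x}^*$ admits the following characterization. (a) If $\|\bm{y}\|_\infty>\gamma\lambda$, then $$\bm{x}^*=\frac{\|\mathcal{S}_{\gamma\lambda}(\bm{y})\|_2+\alpha\gamma\lambda}{(1+2\lambda(1-\gamma))\,\|\mathcal{S}_{\gamma\lambda}(\bm{y})\|_2}\;\mathcal{S}_{\gamma\lambda}(\bm{y}).$$ (b) If $\|\bm{y}\|_\infty=\gamma\lambda$, then the optimal solution $\bm{x}^*$ satisfies $$\bm{x}^*\in\left\{\bm{x}\in\mathbb{R}^n:\ x_i=0\text{ for }|y_i|<\gamma\lambda,\ \|\bm{x}\|_2=\alpha\gamma\lambda,\ x_iy_i\ge 0\ \forall i\right\},$$ and $\bm{x}^*$ is non-unique if there are multiple indices $i$ with $|y_i|=\gamma\lambda$. (c) If $(1-\alpha)\gamma\lambda<\|\bm{y}\|_\infty<\gamma\lambda$, then $\bm{x}^*$ is $1$-sparse, supported on an index $i$ with $|y_i|=\|\bm{y}\|_\infty$, and $$\bm{x}^*\in\left\{\bm{x}\in\mathbb{R}^n:\ \|\bm{x}\|_2=\|\bm{y}\|_\infty+(\alpha-1)\gamma\lambda,\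 x_iy_i\ge 0\right\}.$$ (d) If $\|\bm{y}\|_\infty\le(1-\alpha)\gamma\lambda$, then $\bm{x}^*=\bm{0}$.
   Context: $\mathcal{S}_{\gamma\lambda}(\bm{y})=\operatorname{sign}(\bm{y})\odot\max(|\bm{y}|-\gamma\lambda,\bm{0})$ denotes componentwise soft-thresholding with threshold $\gamma\lambda$, where $\odot$ is the componentwise product. A vector is $1$-sparse if it has at most one nonzero entry.
   Formalization: The norms in (b) and (c) are divided by 1+2λ(1−γ), since the printed values fail (n=1, λ=1, γ=1/2, α=1 gives x*=y/2); non-uniqueness in (b) is claimed only for α>0, since for α=0 the objective is strictly convex and x*=0 is unique. *)

theory Defs
  imports "HOL-Analysis.Analysis"
begin

text \<open>
  On \<^typ>\<open>real ^ 'n\<close> the library's \<^const>\<open>norm\<close> is the Euclidean norm and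
  \<^const>\<open>infnorm\<close> is the maximum norm; the 1-norm is not in the library.
\<close>

definition l1_norm :: "real ^ 'n \<Rightarrow> real" where
  "l1_norm x = (\<Sum>i\<in>UNIV. \<bar>x $ i\<bar>)"

definition soft_threshold :: "real \<Rightarrow> real ^ 'n \<Rightarrow> real ^ 'n" where
  "soft_threshold t y = (\<chi> i. sgn (y $ i) * max (\<bar>y $ i\<bar> - t) 0)"

definition one_sparse :: "real ^ 'n \<Rightarrow> bool" where
  "one_sparse x \<longleftrightarrow> card {i. x $ i \<noteq> 0} \<le> 1"

definition objective :: "real \<Rightarrow> real \<Rightarrow> real \<Rightarrow> real ^ 'n \<Rightarrow> real ^ 'n \<Rightarrow> real" where
  "objective \<gamma> \<alpha> lam y x =
     \<gamma> * (l1_norm x - \<alpha> * norm x) + (1 - \<gamma>) * (norm x)\<^sup>2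
       + 1 / (2 * lam) * (norm (x - y))\<^sup>2"

definition optimal_solution :: "real \<Rightarrow> real \<Rightarrow> real \<Rightarrow> real ^ 'n \<Rightarrow> real ^ 'n \<Rightarrow> bool" where
  "optimal_solution \<gamma> \<alpha> lam y x \<longleftrightarrow> is_arg_min (objective \<gamma> \<alpha> lam y) (\<lambda>_. True) x"

text \<open>
  Up to a constant, \<open>lam\<close> times the objective is
  \<open>c / 2 * (norm x)\<^sup>2 - x \<bullet> y + \<gamma> * lam * l1_norm x - \<alpha> * \<gamma> * lam * norm x\<close> with
  \<open>c = 1 + 2 * lam * (1 - \<gamma>) > 1\<close>. Hence every minimiser scales with \<open>1 / c\<close>, not only
  those for \<open>infnorm y > \<gamma> * lam\<close>. The source omits this factor from its radii for
  \<open>infnorm y \<le> \<gamma> * lam\<close>, and it claims non-uniqueness for \<open>infnorm y = \<gamma> * lam\<close> even if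
  \<open>\<alpha> = 0\<close>, where 0 is the only minimiser. Both claims are false as printed; the theorem
  stated with these definitions has the factor in those radii and requires \<open>\<alpha> > 0\<close> for
  non-uniqueness.
\<close>

end

theory Submission
  imports Defs
begin

text \<open>
  Up to scaling and a constant the objective is
  \<open>c / 2 * (norm x)\<^sup>2 - b * norm x - gain t y x\<close>, where
  \<open>c = 1 + 2 * lam * (1 - \<gamma>)\<close>, \<open>t = \<gamma> * lam\<close>, \<open>b = \<alpha> * \<gamma> * lam\<close> and
  the gain \<open>x \<bullet> y - t * l1_norm x\<close> is positively homogeneous. If \<open>k\<close> is the maximum of the gain
  on the unit sphere and \<open>b + k \<ge> 0\<close>, then minimising first over directions and then over the
  radius shows that the minimisers are exactly the vectors of norm \<open>(b + k) / c\<close> whose direction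
  maximises the gain. For \<open>infnorm y > t\<close> the only such direction is that of
  \<open>soft_threshold t y\<close>, with \<open>k\<close> its norm. For \<open>infnorm y \<le> t\<close> one has \<open>k = infnorm y - t\<close>,
  attained at signed unit vectors. If \<open>b + k \<le> 0\<close>, the minimiser is 0.
\<close>

section \<open>Reduction to the gain and the radius\<close>

definition gain :: "real \<Rightarrow> real ^ 'n \<Rightarrow> real ^ 'n \<Rightarrow> real" where
  "gain t y x = x \<bullet> y - t * l1_norm x"

lemma gain_sum: "gain t y x = (\<Sum>i\<in>UNIV. x $ i * y $ i - t * \<bar>x $ i\<bar>)"
  by (simp add: gain_def l1_norm_def inner_vec_def sum_subtractf sum_distrib_left)

lemma gain_scaleR:
  assumes "a \<ge> 0"
  shows "gain t y (a *\<^sub>R x) = a * gain t y x"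
  using assms by (simp add: gain_sum abs_mult sum_distrib_left algebra_simps)

lemma objective_eq_gain:
  fixes x y :: "real ^ 'n"
  assumes "lam > 0"
  shows "lam * objective \<gamma> \<alpha> lam y x =
    (1 + 2 * lam * (1 - \<gamma>)) / 2 * (norm x)\<^sup>2 - \<alpha> * \<gamma> * lam * norm x - gain (\<gamma> * lam) y x
      + (norm y)\<^sup>2 / 2"
proof -
  have "(norm (x - y))\<^sup>2 = (norm x)\<^sup>2 - 2 * (x \<bullet> y) + (norm y)\<^sup>2"
    by (simp add: power2_norm_eq_inner inner_diff_left inner_diff_right inner_commute)
  then show ?thesis
    using assms unfolding objective_def gain_def by (simp add: algebra_simps) (simp add: field_simps)
qed

lemma optimal_solution_iff_gain:
  fixes x y :: "real ^ 'n"
  assumes "lam > 0"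
    and "c = 1 + 2 * lam * (1 - \<gamma>)" and "b = \<alpha> * \<gamma> * lam" and "t = \<gamma> * lam"
  shows "optimal_solution \<gamma> \<alpha> lam y x \<longleftrightarrow>
    (\<forall>z. c / 2 * (norm x)\<^sup>2 - b * norm x - gain t y x \<le> c / 2 * (norm z)\<^sup>2 - b * norm z - gain t y z)"
proof -
  have "optimal_solution \<gamma> \<alpha> lam y x \<longleftrightarrow>
      (\<forall>z. lam * objective \<gamma> \<alpha> lam y x \<le> lam * objective \<gamma> \<alpha> lam y z)"
    using assms(1) by (simp add: optimal_solution_def is_arg_min_linorder)
  then show ?thesis
    using objective_eq_gain[OF assms(1), of \<gamma> \<alpha> y] assms(2-4) by simp
qed

text \<open>Completing the square in the norm splits the objective into a constant, a square that
  measures the error of the radius, and the defect \<open>k * norm z - g z\<close>. Neither of the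
  last two is negative, and both vanish at a nonnegative multiple of \<open>u\<close>, so a
  minimiser is a common zero of them.\<close>

lemma minimiser_iff_of_sharp_bound:
  fixes x u :: "'a :: real_normed_vector" and g :: "'a \<Rightarrow> real"
  assumes "c > 0" and "b + k \<ge> 0"
    and bound: "\<And>z. g z \<le> k * norm z"
    and hom: "\<And>a z. a \<ge> 0 \<Longrightarrow> g (a *\<^sub>R z) = a * g z"
    and u: "norm u = 1" "g u = k"
  shows "(\<forall>z. c / 2 * (norm x)\<^sup>2 - b * norm x - g x \<le> c / 2 * (norm z)\<^sup>2 - b * norm z - g z)
    \<longleftrightarrow> norm x = (b + k) / c \<and> g x = k * norm x"
    (is "_ \<longleftrightarrow> ?R")
proof -
  define F where "F z = c / 2 * (norm z)\<^sup>2 - b * norm z - g z" for z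
  \<comment> \<open>The minimum of the radial parabola
    \<open>c / 2 * r\<^sup>2 - (b + k) * r\<close>, taken at \<open>r = (b + k) / c\<close>.\<close>
  define m where "m = - (b + k)\<^sup>2 / (2 * c)"
  have F: "F z = m + c / 2 * (norm z - (b + k) / c)\<^sup>2 + (k * norm z - g z)" for z
    using \<open>c > 0\<close> by (simp add: F_def m_def field_simps power2_eq_square)
  have lower: "m \<le> F z" for z
    using bound[of z] \<open>c > 0\<close> by (simp add: F)
  have attained: "F (((b + k) / c) *\<^sub>R u) = m"
    using assms by (simp add: F)
  have "(\<forall>z. F x \<le> F z) \<longleftrightarrow> F x = m"
    using lower attained by (metis order_antisym)
  also have "\<dots> \<longleftrightarrow> c / 2 * (norm x - (b + k) / c)\<^sup>2 + (k * norm x - g x) = 0"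
    by (simp add: F)
  also have "\<dots> \<longleftrightarrow> ?R"
    using \<open>c > 0\<close> bound[of x] by (subst add_nonneg_eq_0_iff) auto
  finally show ?thesis
    by (simp add: F_def)
qed

section \<open>The gain above the threshold\<close>

lemma soft_threshold_term_le:
  fixes a v t :: real
  assumes "t \<ge> 0"
  shows "a * v - t * \<bar>a\<bar> \<le> a * (sgn v * max (\<bar>v\<bar> - t) 0)"
proof (cases "\<bar>v\<bar> \<le> t")
  case True
  have "a * v \<le> \<bar>a\<bar> * \<bar>v\<bar>"
    by (metis abs_ge_self abs_mult)
  also have "\<dots> \<le> t * \<bar>a\<bar>"
    using mult_left_mono[OF True, of "\<bar>a\<bar>"] by (simp add: mult.commute)
  finally show ?thesis
    using True by (simp add: max_def)
next
  case False
  \<comment> \<open>Above the threshold the two sides of the goal differ by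
    \<open>t * (\<bar>a\<bar> - a * sgn v)\<close>.\<close>
  have "t * (a * sgn v) \<le> t * \<bar>a\<bar>"
    using assms by (intro mult_left_mono) (auto simp: sgn_if)
  moreover have "a * (sgn v * max (\<bar>v\<bar> - t) 0) = a * v - t * (a * sgn v)"
    using False by (simp add: max_def sgn_if algebra_simps)
  ultimately show ?thesis
    by simp
qed

text \<open>Linearises the gain, so that Cauchy-Schwarz gives both the sharp bound on the unit
  sphere and, through its equality case, the only maximising direction.\<close>

lemma gain_le_inner_soft_threshold:
  assumes "t \<ge> 0"
  shows "gain t y x \<le> x \<bullet> soft_threshold t y"
  using assms
  by (auto simp: gain_sum inner_vec_def soft_threshold_def intro!: sum_mono soft_threshold_term_le)

lemma gain_soft_threshold:
  assumes "t \<ge> 0"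
  shows "gain t y (soft_threshold t y) = (norm (soft_threshold t y))\<^sup>2"
proof -
  \<comment> \<open>A nonzero \<open>a\<close> has the sign of \<open>v\<close> and modulus
    \<open>\<bar>v\<bar> - t\<close>, so the left side is
    \<open>\<bar>a\<bar> * (\<bar>v\<bar> - t)\<close>.\<close>
  have "a * v - t * \<bar>a\<bar> = a * a" if "a = sgn v * max (\<bar>v\<bar> - t) 0" for a v
    using that assms by (auto simp: sgn_if max_def algebra_simps abs_mult)
  then show ?thesis
    by (simp add: gain_sum power2_norm_eq_inner inner_vec_def soft_threshold_def)
qed

lemma infnorm_attained_cart:
  fixes y :: "real ^ 'n"
  obtains i where "\<bar>y $ i\<bar> = infnorm y"
proof -
  have "infnorm y = Max (range (\<lambda>i. \<bar>y $ i\<bar>))"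
    unfolding infnorm_cart by (subst cSup_eq_Max) (auto simp: full_SetCompr_eq)
  moreover have "Max (range (\<lambda>i. \<bar>y $ i\<bar>)) \<in> range (\<lambda>i. \<bar>y $ i\<bar>)"
    by (intro Max_in) auto
  ultimately show ?thesis
    using that by (metis imageE)
qed

lemma soft_threshold_nonzero:
  assumes "t \<ge> 0" and "t < infnorm y"
  shows "soft_threshold t y \<noteq> 0"
proof -
  obtain i where "\<bar>y $ i\<bar> = infnorm y"
    by (rule infnorm_attained_cart)
  then have "soft_threshold t y $ i \<noteq> 0"
    using assms by (auto simp: soft_threshold_def sgn_if)
  then show ?thesis
    by auto
qed

section \<open>The gain at and below the threshold\<close>

lemma mult_le_infnorm_cart: "x $ i * y $ i \<le> infnorm y * \<bar>x $ i\<bar>"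
proof -
  have "x $ i * y $ i \<le> \<bar>y $ i\<bar> * \<bar>x $ i\<bar>"
    by (metis abs_ge_self abs_mult mult.commute)
  also have "\<dots> \<le> infnorm y * \<bar>x $ i\<bar>"
    by (intro mult_right_mono component_le_infnorm_cart) simp
  finally show ?thesis .
qed

lemma gain_le_l1_norm: "gain t y x \<le> (infnorm y - t) * l1_norm x"
proof -
  have "gain t y x \<le> (\<Sum>i\<in>UNIV. (infnorm y - t) * \<bar>x $ i\<bar>)"
    unfolding gain_sum by (intro sum_mono) (simp add: left_diff_distrib mult_le_infnorm_cart)
  then show ?thesis
    by (simp add: l1_norm_def sum_distrib_left)
qed

lemma norm_le_l1_norm: "norm x \<le> l1_norm x"
  by (simp add: l1_norm_def norm_le_l1_cart)

text \<open>The factor \<open>infnorm y - t\<close> is nonpositive, so passing from the 1-norm to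
  the smaller Euclidean norm can only raise the bound.\<close>

lemma gain_le_norm:
  assumes "infnorm y \<le> t"
  shows "gain t y x \<le> (infnorm y - t) * norm x"
proof -
  have "(infnorm y - t) * l1_norm x \<le> (infnorm y - t) * norm x"
    using assms norm_le_l1_norm by (intro mult_left_mono_neg) auto
  then show ?thesis
    using gain_le_l1_norm order_trans by blast
qed

text \<open>The sign is 1 where \<open>y $ i = 0\<close>, whereas \<open>sgn\<close> would give the
  zero vector; the case \<open>y = 0\<close> needs a unit vector too.\<close>

definition signed_axis :: "real ^ 'n \<Rightarrow> 'n \<Rightarrow> real ^ 'n" where
  "signed_axis y i = axis i (if y $ i \<ge> 0 then 1 else -1)"

lemma norm_signed_axis: "norm (signed_axis y i) = 1"
  by (simp add: signed_axis_def norm_axis_1 norm_eq_sqrt_inner inner_axis_axis)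

lemma gain_signed_axis: "gain t y (signed_axis y i) = \<bar>y $ i\<bar> - t"
proof -
  have "l1_norm (signed_axis y i) = (\<Sum>j\<in>UNIV. if j = i then 1 else 0)"
    unfolding l1_norm_def by (intro sum.cong) (auto simp: signed_axis_def axis_def)
  then show ?thesis
    by (simp add: gain_def signed_axis_def inner_axis inner_axis')
qed

text \<open>Equality in the Hoelder bound: the componentwise gaps are nonnegative and sum to 0, so
  each is 0.\<close>

lemma gain_eq_l1_norm_imp:
  assumes "gain t y x = (infnorm y - t) * l1_norm x"
  shows "x $ i * y $ i = infnorm y * \<bar>x $ i\<bar>"
proof -
  have "(\<Sum>i\<in>UNIV. infnorm y * \<bar>x $ i\<bar> - x $ i * y $ i) = 0"
    using assms
    by (simp add: gain_def l1_norm_def inner_vec_def sum_subtractf sum_distrib_left algebra_simps)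
  then have "\<forall>i\<in>UNIV. infnorm y * \<bar>x $ i\<bar> - x $ i * y $ i = 0"
    using mult_le_infnorm_cart[of x _ y] by (subst (asm) sum_nonneg_eq_0_iff) auto
  then show ?thesis
    by auto
qed

text \<open>The nonnegative terms \<open>\<bar>x $ j\<bar> * (norm x - \<bar>x $ j\<bar>)\<close>
  sum to \<open>norm x * (l1_norm x - norm x) = 0\<close>. So every nonzero entry has modulus
  \<open>norm x\<close>, and one such entry already exhausts the 1-norm.\<close>

lemma support_singleton_of_l1_norm_eq:
  fixes x :: "real ^ 'n"
  assumes "l1_norm x = norm x" and "x \<noteq> 0"
  obtains i where "{j. x $ j \<noteq> 0} = {i}"
proof -
  have "(\<Sum>j\<in>UNIV. \<bar>x $ j\<bar> * \<bar>x $ j\<bar>) = norm x * norm x"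
    using power2_norm_eq_inner[of x] by (simp add: inner_vec_def power2_eq_square)
  then have "(\<Sum>j\<in>UNIV. \<bar>x $ j\<bar> * (norm x - \<bar>x $ j\<bar>)) = 0"
    using assms(1)
    by (simp add: l1_norm_def right_diff_distrib sum_subtractf flip: sum_distrib_right)
  then have extreme: "\<forall>j\<in>UNIV. \<bar>x $ j\<bar> * (norm x - \<bar>x $ j\<bar>) = 0"
    by (subst (asm) sum_nonneg_eq_0_iff) (auto simp: component_le_norm_cart)
  obtain i where i: "x $ i \<noteq> 0"
    using assms(2) by (auto simp: vec_eq_iff)
  have "\<bar>x $ i\<bar> + (\<Sum>j\<in>UNIV - {i}. \<bar>x $ j\<bar>) = norm x"
    using assms(1) sum.remove[of UNIV i "\<lambda>j. \<bar>x $ j\<bar>"] by (simp add: l1_norm_def)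
  moreover have "\<bar>x $ i\<bar> = norm x"
    using extreme i by auto
  ultimately have "(\<Sum>j\<in>UNIV - {i}. \<bar>x $ j\<bar>) = 0"
    by simp
  then have "\<forall>j\<in>UNIV - {i}. x $ j = 0"
    by (subst (asm) sum_nonneg_eq_0_iff) auto
  with i show ?thesis
    by (intro that[of i]) auto
qed

section \<open>The minimisers according to the size of \<open>infnorm y\<close>\<close>

theorem lemma12:
  fixes y xs :: "real ^ 'n" and lam \<gamma> \<alpha> :: real
  assumes "lam > 0" and "0 < \<gamma>" and "\<gamma> < 1" and "\<alpha> \<ge> 0"
    and "optimal_solution \<gamma> \<alpha> lam y xs"
  shows
    "(infnorm y > \<gamma> * lam \<longrightarrow>
        xs = ((norm (soft_threshold (\<gamma> * lam) y) + \<alpha> * \<gamma> * lam)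
              / ((1 + 2 * lam * (1 - \<gamma>)) * norm (soft_threshold (\<gamma> * lam) y)))
             *\<^sub>R soft_threshold (\<gamma> * lam) y)
   \<and> (infnorm y = \<gamma> * lam \<longrightarrow>
        xs \<in> {x. (\<forall>i. \<bar>y $ i\<bar> < \<gamma> * lam \<longrightarrow> x $ i = 0)
                 \<and> norm x = \<alpha> * \<gamma> * lam / (1 + 2 * lam * (1 - \<gamma>))
                 \<and> (\<forall>i. x $ i * y $ i \<ge> 0)}
      \<and> (\<alpha> > 0 \<and> (\<exists>i j. i \<noteq> j \<and> \<bar>y $ i\<bar> = \<gamma> * lam \<and> \<bar>y $ j\<bar> = \<gamma> * lam) \<longrightarrow>
           (\<exists>x'. optimal_solution \<gamma> \<alpha> lam y x' \<and> x' \<noteq> xs)))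
   \<and> ((1 - \<alpha>) * \<gamma> * lam < infnorm y \<and> infnorm y < \<gamma> * lam \<longrightarrow>
        one_sparse xs
      \<and> (\<exists>i. \<bar>y $ i\<bar> = infnorm y \<and> {j. xs $ j \<noteq> 0} = {i}
            \<and> xs \<in> {x. norm x = (infnorm y + (\<alpha> - 1) * \<gamma> * lam) / (1 + 2 * lam * (1 - \<gamma>))
                       \<and> x $ i * y $ i \<ge> 0}))
   \<and> (infnorm y \<le> (1 - \<alpha>) * \<gamma> * lam \<longrightarrow> xs = 0)"
proof (intro conjI impI)
  define c where "c = 1 + 2 * lam * (1 - \<gamma>)"
  define b where "b = \<alpha> * \<gamma> * lam"
  define t where "t = \<gamma> * lam"
  have c: "c > 0"
    using assms by (simp add: c_def add_pos_nonneg)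
  have b: "b \<ge> 0" and t: "t > 0"
    using assms by (simp_all add: b_def t_def)
  note optimal_iff = optimal_solution_iff_gain[OF assms(1) c_def b_def t_def]
  have min: "c / 2 * (norm xs)\<^sup>2 - b * norm xs - gain t y xs
      \<le> c / 2 * (norm z)\<^sup>2 - b * norm z - gain t y z" for z
    using assms(5) optimal_iff by blast
  have optimal_iff_direction: "optimal_solution \<gamma> \<alpha> lam y x \<longleftrightarrow>
      norm x = (b + k) / c \<and> gain t y x = k * norm x"
    if "b + k \<ge> 0" "\<And>z. gain t y z \<le> k * norm z" "norm u = 1" "gain t y u = k" for k u x
    unfolding optimal_iff
    using c that by (intro minimiser_iff_of_sharp_bound) (auto simp: gain_scaleR)
  have small: "optimal_solution \<gamma> \<alpha> lam y x \<longleftrightarrow>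
      norm x = (b + (infnorm y - t)) / c \<and> gain t y x = (infnorm y - t) * norm x"
    if "infnorm y \<le> t" "b + (infnorm y - t) \<ge> 0" for x
  proof -
    obtain i where "\<bar>y $ i\<bar> = infnorm y"
      by (rule infnorm_attained_cart)
    then show ?thesis
      using that
      by (intro optimal_iff_direction[of _ "signed_axis y i"])
         (auto simp: gain_le_norm norm_signed_axis gain_signed_axis)
  qed
  {
    assume "infnorm y > \<gamma> * lam"
    define s where "s = soft_threshold t y"
    have "s \<noteq> 0"
      using \<open>infnorm y > \<gamma> * lam\<close> t soft_threshold_nonzero[of t y] by (simp add: s_def t_def)
    have le: "gain t y z \<le> z \<bullet> s" for z
      using gain_le_inner_soft_threshold[of t y z] t by (simp add: s_def)
    have "gain t y (s /\<^sub>R norm s) = norm s"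
      using t \<open>s \<noteq> 0\<close> gain_soft_threshold[of t y]
      by (simp add: gain_scaleR s_def[symmetric] power2_eq_square)
    moreover have "gain t y z \<le> norm s * norm z" for z
      using le[of z] norm_cauchy_schwarz[of z s] by (simp add: mult.commute)
    ultimately have "norm xs = (b + norm s) / c \<and> gain t y xs = norm s * norm xs"
      using optimal_iff_direction[of "norm s" "s /\<^sub>R norm s" xs] assms(5) \<open>s \<noteq> 0\<close> b by simp
    \<comment> \<open>The chain from the gain through \<open>xs \<bullet> s\<close> to
      \<open>norm xs * norm s\<close> has equal ends, which forces equality in
      Cauchy-Schwarz.\<close>
    then have nx: "norm xs = (b + norm s) / c" and cs: "xs \<bullet> s = norm xs * norm s"
      using le[of xs] norm_cauchy_schwarz[of xs s] by (auto simp: mult.commute)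
    from cs have "norm s *\<^sub>R xs = norm xs *\<^sub>R s"
      by (simp add: norm_cauchy_schwarz_eq)
    then have "xs = (norm xs / norm s) *\<^sub>R s"
      using \<open>s \<noteq> 0\<close> by (simp add: vec_eq_iff field_simps)
    then show "xs = ((norm (soft_threshold (\<gamma> * lam) y) + \<alpha> * \<gamma> * lam)
              / ((1 + 2 * lam * (1 - \<gamma>)) * norm (soft_threshold (\<gamma> * lam) y)))
             *\<^sub>R soft_threshold (\<gamma> * lam) y"
      using nx by (simp add: s_def b_def c_def t_def add.commute)
  next
    assume eq: "infnorm y = \<gamma> * lam"
    have iff: "optimal_solution \<gamma> \<alpha> lam y x \<longleftrightarrow> norm x = b / c \<and> gain t y x = 0" for x
      using small[of x] eq b by (simp add: t_def)
    have x: "norm xs = b / c" "gain t y xs = 0"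
      using iff assms(5) by auto
    \<comment> \<open>Since \<open>infnorm y = t\<close>, gain 0 is the equality case of the 1-norm
      bound.\<close>
    have prod: "xs $ i * y $ i = t * \<bar>xs $ i\<bar>" for i
      using gain_eq_l1_norm_imp[of t y xs i] x eq by (simp add: t_def)
    have "xs $ i = 0" if "\<bar>y $ i\<bar> < t" for i
    proof (rule ccontr)
      assume "xs $ i \<noteq> 0"
      then have "\<bar>xs $ i\<bar> * \<bar>y $ i\<bar> < \<bar>xs $ i\<bar> * t"
        using that by simp
      moreover have "xs $ i * y $ i \<le> \<bar>xs $ i\<bar> * \<bar>y $ i\<bar>"
        by (metis abs_ge_self abs_mult)
      ultimately show False
        using prod[of i] by (simp add: mult.commute)
    qed
    then show "xs \<in> {x. (\<forall>i. \<bar>y $ i\<bar> < \<gamma> * lam \<longrightarrow> x $ i = 0)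
                 \<and> norm x = \<alpha> * \<gamma> * lam / (1 + 2 * lam * (1 - \<gamma>))
                 \<and> (\<forall>i. x $ i * y $ i \<ge> 0)}"
      using x prod t by (simp add: t_def b_def c_def)
    assume "\<alpha> > 0 \<and> (\<exists>i j. i \<noteq> j \<and> \<bar>y $ i\<bar> = \<gamma> * lam \<and> \<bar>y $ j\<bar> = \<gamma> * lam)"
    then obtain i j where ij: "\<alpha> > 0" "i \<noteq> j" "\<bar>y $ i\<bar> = t" "\<bar>y $ j\<bar> = t"
      by (auto simp: t_def)
    have "b > 0"
      using ij assms by (simp add: b_def)
    \<comment> \<open>Every index with \<open>\<bar>y $ l\<bar> = t\<close> gives a direction of
      gain 0. Two such indices give minimisers that \<open>b > 0\<close> keeps distinct, and
      \<open>xs\<close> differs from at least one of them.\<close>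
    have opt: "optimal_solution \<gamma> \<alpha> lam y ((b / c) *\<^sub>R signed_axis y l)" if "\<bar>y $ l\<bar> = t" for l
      using that b c by (simp add: iff gain_scaleR gain_signed_axis norm_signed_axis)
    have "signed_axis y i \<noteq> signed_axis y j"
      using ij by (auto simp: signed_axis_def axis_eq_axis)
    then have "(b / c) *\<^sub>R signed_axis y i \<noteq> (b / c) *\<^sub>R signed_axis y j"
      using \<open>b > 0\<close> c by simp
    then show "\<exists>x'. optimal_solution \<gamma> \<alpha> lam y x' \<and> x' \<noteq> xs"
      using opt ij by metis
  next
    assume mid: "(1 - \<alpha>) * \<gamma> * lam < infnorm y \<and> infnorm y < \<gamma> * lam"
    then have pos: "b + (infnorm y - t) > 0" and lt: "infnorm y < t"
      by (simp_all add: b_def t_def algebra_simps)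
    have x: "norm xs = (b + (infnorm y - t)) / c" "gain t y xs = (infnorm y - t) * norm xs"
      using small pos lt assms(5) by auto
    have "xs \<noteq> 0"
      using x pos c by auto
    \<comment> \<open>Cancelling the negative factor reverses the inequality and bounds the 1-norm
      by the Euclidean norm.\<close>
    have "(infnorm y - t) * norm xs \<le> (infnorm y - t) * l1_norm xs"
      using gain_le_l1_norm[of t y xs] x by simp
    then have l1: "l1_norm xs = norm xs"
      using lt norm_le_l1_norm[of xs] by (simp add: mult_le_cancel_left)
    obtain i where i: "{j. xs $ j \<noteq> 0} = {i}"
      using support_singleton_of_l1_norm_eq[OF l1 \<open>xs \<noteq> 0\<close>] .
    have prod: "xs $ i * y $ i = infnorm y * \<bar>xs $ i\<bar>"
      using gain_eq_l1_norm_imp[of t y xs i] x l1 by simp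
    \<comment> \<open>Absolute values on both sides of \<open>prod\<close>; the nonzero
      \<open>xs $ i\<close> then cancels.\<close>
    then have "\<bar>xs $ i\<bar> * \<bar>y $ i\<bar> = \<bar>xs $ i\<bar> * infnorm y"
      using infnorm_pos_le[of y] by (metis abs_abs abs_mult abs_of_nonneg mult.commute)
    then have "\<bar>y $ i\<bar> = infnorm y"
      using i by auto
    moreover have "xs $ i * y $ i \<ge> 0"
      by (simp add: prod infnorm_pos_le)
    ultimately show "\<exists>i. \<bar>y $ i\<bar> = infnorm y \<and> {j. xs $ j \<noteq> 0} = {i}
            \<and> xs \<in> {x. norm x = (infnorm y + (\<alpha> - 1) * \<gamma> * lam) / (1 + 2 * lam * (1 - \<gamma>))
                       \<and> x $ i * y $ i \<ge> 0}"
      using i x by (intro exI[of _ i]) (simp add: b_def c_def t_def algebra_simps)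
    show "one_sparse xs"
      by (simp add: one_sparse_def i)
  next
    assume "infnorm y \<le> (1 - \<alpha>) * \<gamma> * lam"
    then have k: "infnorm y - t \<le> - b"
      by (simp add: b_def t_def algebra_simps)
    have "gain t y xs \<le> (infnorm y - t) * norm xs"
      using k b by (intro gain_le_norm) simp
    also have "\<dots> \<le> - b * norm xs"
      using k by (intro mult_right_mono) auto
    \<comment> \<open>In the comparison with the value at 0, the terms
      \<open>- b * norm xs - gain t y xs\<close> are together nonnegative, so the quadratic term
      alone is at most 0.\<close>
    finally have "c / 2 * (norm xs)\<^sup>2 \<le> 0"
      using min[of 0] by (simp add: gain_def l1_norm_def)
    then show "xs = 0"
      using c by (simp add: mult_le_0_iff)
  }
qed

end
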